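(* Let $n\ge 2$, $k\in\{1,\dots,n-1\}$, $r:=\binom{n}{k}$, and $A\in\mathbb{C}^{n\times n}$. Let $U=U(k,n)\in\{-1,0,1\}^{r\times r}$ be the signed anti-diagonal matrix with $u_{ij}=s(\alpha^j)$ if $i+j=r+1$ and $u_{ij}=0$ otherwise. Then $$ (A^{(k)})^T\, U^T A^{(n-k)} U=\det(A)\, I_r . $$
   Context: $Q(k,n)$ denotes the list $\alpha^1,\dots,\alpha^r$ of all $r=\binom{n}{k}$ increasing sequences of $k$ integers from $\{1,\dots,n\}$, ordered lexicographically. For $\alpha,\beta\in Q(k,n)$, $A(\alpha|\beta)$ is the determinant of the $k\times k$ submatrix of $A$ with rows indexed by $\alpha$ and columns indexed by $\beta$. The $k$-multiplicative compound $A^{(k)}$ is the $\binom{n}{k}\times\binom{n}{k}$ matrix of all $k$-minors of $A$ in lexicographic order, i.e. $(A^{(k)})_{ij}=A(\alpha^i|\alpha^j)$; $A^{(n-k)}$ is defined in the same way using the lexicographic order on $Q(n-k,n)$. The signature of $\alpha^j=(\alpha^j_1,\dots,\alpha^j_k)\in Q(k,n)$ is $s(\alpha^j):=(-1)^{\alpha^j_1+\dots+\alpha^j_k}$. $I_r$ is the $r\times r$ identity matrix. *)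

theory Defs
  imports "Jordan_Normal_Form.Determinant" "HOL-Library.List_Lexorder"
begin

text \<open>
  Index sequences carry the entries \<open>1, \<dots>, n\<close>, whereas matrix positions and list
  positions start at \<open>0\<close>: the sequence \<open>\<alpha>\<^sup>i\<close> is \<open>Q k n ! (i - 1)\<close>, and matrix row \<open>m\<close> is
  row \<open>m - 1\<close> of a \<open>mat\<close>. Lists are compared by the lexicographic order of
  \<open>HOL-Library.List_Lexorder\<close>.
\<close>

definition Q :: "nat \<Rightarrow> nat \<Rightarrow> nat list list" where
  "Q k n = sorted_list_of_set {\<alpha>. length \<alpha> = k \<and> set \<alpha> \<subseteq> {1..n} \<and> sorted_wrt (<) \<alpha>}"

definition minor :: "'a :: comm_ring_1 mat \<Rightarrow> nat list \<Rightarrow> nat list \<Rightarrow> 'a" where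
  "minor A \<alpha> \<beta> = det (mat (length \<alpha>) (length \<beta>) (\<lambda>(i, j). A $$ (\<alpha> ! i - 1, \<beta> ! j - 1)))"

text \<open>Meant for square matrices, whose size is read off as \<open>dim_row A\<close>.\<close>

definition mult_compound :: "nat \<Rightarrow> 'a :: comm_ring_1 mat \<Rightarrow> 'a mat" where
  "mult_compound k A = (let n = dim_row A; r = n choose k in
     mat r r (\<lambda>(i, j). minor A (Q k n ! i) (Q k n ! j)))"

definition signature :: "nat list \<Rightarrow> 'a :: comm_ring_1" where
  "signature \<alpha> = (- 1) ^ sum_list \<alpha>"

definition U_mat :: "nat \<Rightarrow> nat \<Rightarrow> 'a :: comm_ring_1 mat" where
  "U_mat k n = (let r = n choose k in
     mat r r (\<lambda>(i, j). if (i + 1) + (j + 1) = r + 1 then signature (Q k n ! j) else 0))"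

lemma finite_increasing_seqs:
  "finite {\<alpha>. length \<alpha> = k \<and> set \<alpha> \<subseteq> {1..n} \<and> sorted_wrt (<) (\<alpha> :: nat list)}"
  by (rule finite_subset[OF _ finite_lists_length_eq[of "{1..n}" k]]) auto

lemma set_Q: "set (Q k n) = {\<alpha>. length \<alpha> = k \<and> set \<alpha> \<subseteq> {1..n} \<and> sorted_wrt (<) \<alpha>}"
  using finite_increasing_seqs by (simp add: Q_def)

lemma sorted_Q: "sorted_wrt (<) (Q k n)"
  by (simp add: Q_def)

lemma length_Q: "length (Q k n) = n choose k"
proof -
  let ?S = "{\<alpha>. length \<alpha> = k \<and> set \<alpha> \<subseteq> {1..n} \<and> sorted_wrt (<) (\<alpha> :: nat list)}"
  let ?T = "{B. B \<subseteq> {1..n} \<and> card B = k}"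
  have fin: "finite B" if "B \<in> ?T" for B
    using that finite_subset by blast
  have "bij_betw set ?S ?T"
  proof (rule bij_betwI[where g = sorted_list_of_set])
    show "set \<in> ?S \<rightarrow> ?T"
      by (auto simp: strict_sorted_iff distinct_card)
    show "sorted_list_of_set \<in> ?T \<rightarrow> ?S"
    proof
      fix B assume B: "B \<in> ?T"
      then show "sorted_list_of_set B \<in> ?S"
        using fin[OF B] by auto
    qed
    show "sorted_list_of_set (set \<alpha>) = \<alpha>" if "\<alpha> \<in> ?S" for \<alpha>
      using that
      by (auto simp: strict_sorted_iff sorted_list_of_set_sort_remdups sorted_sort_id)
    show "set (sorted_list_of_set B) = B" if "B \<in> ?T" for B
      using fin[OF that] by simp
  qed
  then have "card ?S = card ?T"
    by (rule bij_betw_same_card)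
  then show ?thesis
    by (simp add: Q_def n_subsets)
qed

end

theory Submission
  imports Defs
begin

text \<open>
  For \<open>\<beta>, \<gamma> \<in> Q k n\<close> let \<open>B\<close> be the matrix whose columns are the columns \<open>\<beta>\<close> of \<open>A\<close>
  followed by the columns of \<open>A\<close> in the complement of \<open>\<gamma>\<close>. If \<open>\<beta> \<noteq> \<gamma>\<close>, a column occurs
  twice and \<open>det B = 0\<close>; if \<open>\<beta> = \<gamma>\<close>, then \<open>B\<close> is \<open>A\<close> with permuted columns. Laplace
  expansion of \<open>det B\<close> along its first \<open>k\<close> columns gives an entry of the matrix product,
  because complementation maps \<open>Q k n\<close> onto \<open>Q (n - k) n\<close> reversing the lexicographic order,
  so that conjugation with \<open>U\<close> replaces each index by its complement.
\<close>

section \<open>Sign of the reordering that sorts two complementary increasing sequences\<close>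

lemma signature_mult_self: "signature \<alpha> * signature \<alpha> = 1"
  by (simp add: signature_def flip: power_add mult_2)

text \<open>The hypothesis \<open>no_descent\<close> makes \<open>set \<beta>\<close> upward closed
  in \<open>{1..n}\<close>, which forces all of \<open>\<alpha>\<close> below all of
  \<open>\<beta>\<close>. This is the base case of the sorting induction: no adjacent transposition
  is left to perform.\<close>

lemma sorted_append_covering_eq_upt:
  assumes "sorted_wrt (<) \<alpha>" "sorted_wrt (<) \<beta>"
    and "set \<alpha> \<union> set \<beta> = {1..n}" "distinct (\<alpha> @ \<beta>)"
    and no_descent: "\<And>i. i \<in> set \<beta> \<Longrightarrow> Suc i \<notin> set \<alpha>"
  shows "\<alpha> @ \<beta> = [1..<Suc n]"
proof -
  have up: "z \<le> n \<Longrightarrow> z \<in> set \<beta>" if "y \<in> set \<beta>" "y \<le> z" for y z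
    using that(2)
  proof (induction z rule: dec_induct)
    case (step z)
    then have "z \<in> set \<beta>" by simp
    then have "Suc z \<notin> set \<alpha>" by (rule no_descent)
    moreover have "Suc z \<in> set \<alpha> \<union> set \<beta>" using assms(3) step.prems by simp
    ultimately show ?case by blast
  qed (use that in simp)
  have "x < y" if "x \<in> set \<alpha>" "y \<in> set \<beta>" for x y
  proof (rule ccontr)
    assume "\<not> x < y"
    moreover have "x \<le> n" using assms(3) that by auto
    ultimately have "x \<in> set \<beta>" using up[OF that(2)] by simp
    then show False using assms(4) that by auto
  qed
  then have "sorted_wrt (<) (\<alpha> @ \<beta>)"
    using assms(1,2) by (simp add: sorted_wrt_append)
  moreover have "set (\<alpha> @ \<beta>) = set [1..<Suc n]"
    using assms(3) by (simp add: atLeastLessThanSuc_atLeastAtMost del: upt_Suc)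
  ultimately show ?thesis
    by (intro strict_sorted_equal) (auto simp del: upt_Suc)
qed

text \<open>Exchanging two neighbouring values alters no comparison except the one between these two
  values.\<close>

lemma sorted_map_transpose_Suc:
  assumes "sorted_wrt (<) \<alpha>" "i \<notin> set \<alpha> \<or> Suc i \<notin> set \<alpha>"
  shows "sorted_wrt (<) (map (transpose i (Suc i)) \<alpha>)"
  unfolding sorted_wrt_map
  by (rule sorted_wrt_mono_rel[OF _ assms(1)])
    (use assms(2) in \<open>auto simp: transpose_def\<close>)

text \<open>The rows are sorted by adjacent transpositions, each of which changes
  \<^term>\<open>sum_list \<alpha>\<close> by one.\<close>

lemma det_rows_append:
  fixes A :: "'a :: comm_ring_1 mat"
  assumes "A \<in> carrier_mat n n"
    and "sorted_wrt (<) \<alpha>" "sorted_wrt (<) \<beta>"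
    and "set \<alpha> \<union> set \<beta> = {1..n}" "length \<alpha> + length \<beta> = n"
  shows "det (mat n n (\<lambda>(i, j). A $$ ((\<alpha> @ \<beta>) ! i - 1, j)))
    = signature \<alpha> * signature [1..<Suc (length \<alpha>)] * det A"
  using assms
proof (induction "sum_list \<alpha>" arbitrary: \<alpha> \<beta> A rule: less_induct)
  case (less \<alpha> \<beta> A)
  note A = less.prems(1)
  have "card (set (\<alpha> @ \<beta>)) = length (\<alpha> @ \<beta>)"
    using less.prems(4,5) by simp
  then have dist: "distinct (\<alpha> @ \<beta>)" by (rule card_distinct)
  show ?case
  proof (cases "\<exists>i \<in> set \<beta>. Suc i \<in> set \<alpha>")
    case False
    then have eq: "\<alpha> @ \<beta> = [1..<Suc n]"
      using sorted_append_covering_eq_upt less.prems dist by blast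
    \<comment> \<open>Here \<open>\<alpha>\<close> is the initial segment itself, so the two
      signatures in the claim are equal and multiply to 1.\<close>
    then have "take (length \<alpha>) (\<alpha> @ \<beta>) = [1..<Suc (length \<alpha>)]"
      using less.prems(5) by (simp add: take_upt del: upt_Suc)
    then have "signature [1..<Suc (length \<alpha>)] = (signature \<alpha> :: 'a)" by simp
    moreover have "mat n n (\<lambda>(i, j). A $$ ((\<alpha> @ \<beta>) ! i - 1, j)) = A"
      unfolding eq using A by (intro eq_matI) (auto simp del: upt_Suc)
    ultimately show ?thesis by (simp add: signature_mult_self del: upt_Suc)
  next
    case True
    then obtain i where i: "i \<in> set \<beta>" "Suc i \<in> set \<alpha>" by blast
    \<comment> \<open>Since \<open>\<alpha>\<close> contains \<open>Suc i\<close> but not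
      \<open>i\<close>, applying \<open>t\<close> replaces one entry by its predecessor and lowers
      the sum by exactly one.\<close>
    define t where "t = transpose i (Suc i)"
    have ni: "i \<notin> set \<alpha>" "Suc i \<notin> set \<beta>" using dist i by auto
    have "{i, Suc i} \<subseteq> {1..n}" unfolding less.prems(4)[symmetric] using i by auto
    then have in_n: "1 \<le> i" "Suc i \<le> n" by auto
    have sum: "sum_list \<alpha> = Suc (sum_list (map t \<alpha>))"
    proof -
      have "sum t (set \<alpha> - {Suc i}) = \<Sum>(set \<alpha> - {Suc i})"
        using ni by (intro sum.cong) (auto simp: t_def transpose_def)
      then show ?thesis
        using i(2) dist
        by (simp add: sum_list_distinct_conv_sum_set distinct_sum_list_conv_Sum
            sum.remove[of _ "Suc i"] t_def)
    qed
    have t_ran: "t ` {1..n} = {1..n}"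
      using in_n unfolding t_def by (intro transpose_image_eq) auto
    \<comment> \<open>The rows of \<open>A\<close> for the values \<open>i\<close> and
      \<open>Suc i\<close> are at positions \<open>i - 1\<close> and \<open>i\<close>. Swapping them
      compensates the relabelling by \<open>t\<close>, so the left-hand matrix is the original one,
      while \<open>det A\<close> and \<open>signature \<alpha>\<close> both change sign.\<close>
    have IH: "det (mat n n (\<lambda>(a, b). swaprows (i - 1) i A $$ ((map t \<alpha> @ map t \<beta>) ! a - 1, b)))
      = signature (map t \<alpha>) * signature [1..<Suc (length (map t \<alpha>))] * det (swaprows (i - 1) i A)"
    proof (rule less.hyps)
      show "sum_list (map t \<alpha>) < sum_list \<alpha>" using sum by simp
      show "sorted_wrt (<) (map t \<alpha>)" "sorted_wrt (<) (map t \<beta>)"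
        unfolding t_def using ni less.prems(2,3) by (auto intro!: sorted_map_transpose_Suc)
      show "set (map t \<alpha>) \<union> set (map t \<beta>) = {1..n}"
        using t_ran less.prems(4) by (simp flip: image_Un)
    qed (use A less.prems(5) in auto)
    have "mat n n (\<lambda>(a, b). swaprows (i - 1) i A $$ ((map t \<alpha> @ map t \<beta>) ! a - 1, b))
      = mat n n (\<lambda>(a, b). A $$ ((\<alpha> @ \<beta>) ! a - 1, b))"
    proof (rule cong_mat, goal_cases)
      case (3 a b)
      define x where "x = (\<alpha> @ \<beta>) ! a"
      have "x \<in> set (\<alpha> @ \<beta>)" unfolding x_def using 3 less.prems(5) by (intro nth_mem) simp
      then have x: "x \<in> {1..n}" using less.prems(4) by simp
      have nth: "(map t \<alpha> @ map t \<beta>) ! a = t x"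
        unfolding x_def using 3 less.prems(5) by (simp flip: map_append)
      have "swaprows (i - 1) i A $$ (t x - 1, b) = A $$ (x - 1, b)"
        using A x 3 in_n by (auto simp: t_def transpose_def)
      then show ?case by (simp only: nth prod.case flip: x_def)
    qed auto
    moreover have "det (swaprows (i - 1) i A) = - det A"
      using A in_n by (intro det_swaprows[of _ n]) auto
    moreover have "signature \<alpha> = - (signature (map t \<alpha>) :: 'a)"
      by (simp add: signature_def sum)
    ultimately show ?thesis using IH by simp
  qed
qed

section \<open>Laplace expansion along the first columns\<close>

text \<open>A permutation \<open>p\<close> contributes only to the summand with \<open>set \<alpha> = Suc ` p ` {0..<k}\<close>.\<close>

lemma det_eq_sum_masked:
  fixes B :: "'a :: comm_ring_1 mat"
  assumes B: "B \<in> carrier_mat n n" and "k \<le> n"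
  shows "det B = (\<Sum>\<alpha>\<in>set (Q k n).
    det (mat n n (\<lambda>(i, j). if Suc i \<in> set \<alpha> \<longleftrightarrow> j < k then B $$ (i, j) else 0)))"
proof -
  let ?P = "{p. p permutes {0..<n}}"
  define M where "M \<alpha> = mat n n (\<lambda>(i, j). if Suc i \<in> set \<alpha> \<longleftrightarrow> j < k then B $$ (i, j) else 0)"
    for \<alpha> :: "nat list"
  have main: "(\<Sum>\<alpha>\<in>set (Q k n). \<Prod>j<n. M \<alpha> $$ (p j, j)) = (\<Prod>j<n. B $$ (p j, j))"
    if p: "p permutes {0..<n}" for p
  proof -
    define S where "S = Suc ` p ` {0..<k}"
    define \<gamma> where "\<gamma> = sorted_list_of_set S"
    have pn: "p j < n" if "j < n" for j using permutes_in_image[OF p, of j] that by simp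
    have inj: "inj p" using p by (rule permutes_inj)
    have S: "S \<subseteq> {1..n}" "card S = k" "finite S"
      unfolding S_def using pn \<open>k \<le> n\<close> inj
      by (auto simp: card_image inj_on_subset Suc_le_eq)
    then have \<gamma>: "\<gamma> \<in> set (Q k n)" "set \<gamma> = S"
      by (auto simp: \<gamma>_def set_Q)
    have zero: "(\<Prod>j<n. M \<alpha> $$ (p j, j)) = 0" if \<alpha>: "\<alpha> \<in> set (Q k n) - {\<gamma>}" for \<alpha>
    proof -
      have "card (set \<alpha>) = k" "sorted_wrt (<) \<alpha>"
        using \<alpha> by (auto simp: set_Q strict_sorted_iff distinct_card)
      moreover have "sorted_wrt (<) \<gamma>" by (simp add: \<gamma>_def)
      ultimately have "set \<alpha> \<noteq> S" using \<alpha> \<gamma>(2) strict_sorted_equal by blast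
      \<comment> \<open>Both sets have \<open>k\<close> elements, so being different already gives
        some \<open>Suc (p j)\<close> with \<open>j < k\<close> outside \<open>set \<alpha>\<close>;
        the factor of that column is masked.\<close>
      then have "\<not> S \<subseteq> set \<alpha>"
        using \<open>card (set \<alpha>) = k\<close> S(2) card_subset_eq[of "set \<alpha>" S] by auto
      then obtain y where y: "y \<in> S" "y \<notin> set \<alpha>" by blast
      then obtain j where "j < k" "y = Suc (p j)" by (auto simp: S_def)
      moreover have "j < n" using \<open>j < k\<close> \<open>k \<le> n\<close> by simp
      ultimately show ?thesis
        using pn y by (intro prod_zero) (auto simp: M_def intro!: bexI[of _ j])
    qed
    \<comment> \<open>No factor is masked for \<open>\<gamma>\<close>: by injectivity of
      \<open>p\<close>, \<open>Suc (p j)\<close> lies in \<open>S\<close> exactly when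
      \<open>j < k\<close>.\<close>
    have "(\<Prod>j<n. M \<gamma> $$ (p j, j)) = (\<Prod>j<n. B $$ (p j, j))"
      using pn inj by (intro prod.cong) (auto simp: M_def \<gamma>(2) S_def inj_eq)
    then show ?thesis
      using zero \<gamma>(1) by (simp add: sum.remove[of _ \<gamma>])
  qed
  have "(\<Sum>\<alpha>\<in>set (Q k n). det (M \<alpha>))
    = (\<Sum>p\<in>?P. \<Sum>\<alpha>\<in>set (Q k n). signof p * (\<Prod>j<n. M \<alpha> $$ (p j, j)))"
    by (subst sum.swap) (simp add: det_col[of _ n] M_def)
  also have "\<dots> = det B"
    by (simp add: det_col[OF B] main flip: sum_distrib_left)
  finally show ?thesis by (simp add: M_def)
qed

definition complement_seq :: "nat \<Rightarrow> nat list \<Rightarrow> nat list" where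
  "complement_seq n \<alpha> = sorted_list_of_set ({1..n} - set \<alpha>)"

lemma set_complement_seq [simp]: "set (complement_seq n \<alpha>) = {1..n} - set \<alpha>"
  by (simp add: complement_seq_def)

lemma sorted_complement_seq [simp]: "sorted_wrt (<) (complement_seq n \<alpha>)"
  by (simp add: complement_seq_def)

lemma length_complement_seq: "\<alpha> \<in> set (Q k n) \<Longrightarrow> length (complement_seq n \<alpha>) = n - k"
  by (auto simp: complement_seq_def set_Q card_Diff_subset strict_sorted_iff distinct_card)

lemma complement_seq_in_Q: "\<alpha> \<in> set (Q k n) \<Longrightarrow> complement_seq n \<alpha> \<in> set (Q (n - k) n)"
  using length_complement_seq by (auto simp: set_Q)

lemma complement_complement_seq:
  "\<alpha> \<in> set (Q k n) \<Longrightarrow> complement_seq n (complement_seq n \<alpha>) = \<alpha>"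
  by (rule strict_sorted_equal) (auto simp: set_Q)

text \<open>Listing the rows of a masked matrix as \<open>\<alpha>\<close> followed by its
  complement makes it block diagonal, and \<open>det_rows_append\<close> gives the sign of this
  reordering.\<close>

lemma laplace_expansion_columns:
  fixes B :: "'a :: idom mat"
  assumes B: "B \<in> carrier_mat n n" and "k \<le> n"
  shows "det B = (\<Sum>\<alpha>\<in>set (Q k n). signature \<alpha> * signature [1..<Suc k]
    * det (mat k k (\<lambda>(i, j). B $$ (\<alpha> ! i - 1, j)))
    * det (mat (n - k) (n - k) (\<lambda>(i, j). B $$ (complement_seq n \<alpha> ! i - 1, k + j))))"
proof -
  have "det (mat n n (\<lambda>(i, j). if Suc i \<in> set \<alpha> \<longleftrightarrow> j < k then B $$ (i, j) else 0))
    = signature \<alpha> * signature [1..<Suc k]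
    * det (mat k k (\<lambda>(i, j). B $$ (\<alpha> ! i - 1, j)))
    * det (mat (n - k) (n - k) (\<lambda>(i, j). B $$ (complement_seq n \<alpha> ! i - 1, k + j)))"
    (is "det ?M = ?s * ?s' * det ?X * det ?Y")
    if \<alpha>: "\<alpha> \<in> set (Q k n)" for \<alpha>
  proof -
    define \<beta> where "\<beta> = complement_seq n \<alpha>"
    have len: "length \<alpha> = k" "length \<beta> = n - k"
      using \<alpha> length_complement_seq by (auto simp: \<beta>_def set_Q)
    have sub: "set \<alpha> \<subseteq> {1..n}" using \<alpha> by (simp add: set_Q)
    have in\<alpha>: "\<alpha> ! i \<in> set \<alpha>" "\<alpha> ! i \<in> {1..n}" if "i < k" for i
      using that len(1) sub nth_mem by blast+
    have in\<beta>: "\<beta> ! i \<notin> set \<alpha>" "\<beta> ! i \<in> {1..n}" if "i < n - k" for i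
      using nth_mem[of i \<beta>] that len(2) by (auto simp: \<beta>_def)
    have "mat n n (\<lambda>(i, j). ?M $$ ((\<alpha> @ \<beta>) ! i - 1, j))
      = four_block_mat ?X (0\<^sub>m k (n - k)) (0\<^sub>m (n - k) k) ?Y"
    proof (rule eq_matI, goal_cases)
      case (1 i j)
      then have "i < n" "j < n" using \<open>k \<le> n\<close> by auto
      show ?case
      proof (cases "i < k")
        case True
        then show ?thesis
          using in\<alpha>[OF True] \<open>i < n\<close> \<open>j < n\<close> \<open>k \<le> n\<close> len
          by (auto simp: nth_append Suc_le_eq simp flip: \<beta>_def)
      next
        case False
        then have "i - k < n - k" using \<open>i < n\<close> by simp
        from in\<beta>[OF this] show ?thesis
          using False \<open>i < n\<close> \<open>j < n\<close> \<open>k \<le> n\<close> len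
          by (auto simp: nth_append Suc_le_eq simp flip: \<beta>_def)
      qed
    qed (use \<open>k \<le> n\<close> in auto)
    then have "det (mat n n (\<lambda>(i, j). ?M $$ ((\<alpha> @ \<beta>) ! i - 1, j))) = det ?X * det ?Y"
      by (simp add: det_four_block_mat_upper_right_zero[of _ k _ "n - k"])
    moreover have "det (mat n n (\<lambda>(i, j). ?M $$ ((\<alpha> @ \<beta>) ! i - 1, j))) = ?s * ?s' * det ?M"
      using det_rows_append[of ?M n \<alpha> \<beta>] \<alpha> sub len \<open>k \<le> n\<close>
      by (auto simp: \<beta>_def set_Q simp del: upt_Suc)
    ultimately have "det ?X * det ?Y = ?s * ?s' * det ?M" by simp
    \<comment> \<open>Multiplying by the sign once more moves it to the other side, because each
      signature squares to 1.\<close>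
    then have "?s * ?s' * (det ?X * det ?Y) = ?s * ?s' * (?s * ?s' * det ?M)"
      by (simp only:)
    also have "\<dots> = (?s * ?s) * (?s' * ?s') * det ?M"
      by (simp only: ac_simps)
    also have "\<dots> = det ?M" by (simp only: signature_mult_self mult_1)
    finally show ?thesis by (simp only: mult.assoc)
  qed
  then show ?thesis by (subst det_eq_sum_masked[OF assms]) simp
qed

section \<open>Complementation and the lexicographic order\<close>

text \<open>After the common prefix, every entry of \<open>\<beta>\<close> is at least
  \<open>b\<close> and hence exceeds \<open>a\<close>, so \<open>a\<close> is the least element in
  which the two sets differ. Expressing the order through sets makes it easy to follow under
  complementation.\<close>

lemma list_less_imp_first_difference:
  fixes \<alpha> \<beta> :: "'a :: linorder list"
  assumes "\<alpha> < \<beta>" "length \<alpha> = length \<beta>" "sorted_wrt (<) \<alpha>" "sorted_wrt (<) \<beta>"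
  shows "\<exists>m\<in>set \<alpha> - set \<beta>. \<forall>x<m. x \<in> set \<alpha> \<longleftrightarrow> x \<in> set \<beta>"
proof -
  obtain u a v b w where "\<alpha> = u @ a # v" "\<beta> = u @ b # w" "a < b"
    using assms(1,2) by (auto simp: list_less_def lexord_def)
  with assms(3,4) show ?thesis
    by (intro bexI[of _ a]) (auto simp: sorted_wrt_append)
qed

text \<open>The order is total, and \<open>\<beta> < \<alpha>\<close> would produce a first
  difference belonging to \<open>\<beta>\<close>, which is incompatible with \<open>m\<close>
  wherever it lies relative to \<open>m\<close>.\<close>

lemma first_difference_imp_list_less:
  fixes \<alpha> \<beta> :: "'a :: linorder list"
  assumes m: "m \<in> set \<alpha> - set \<beta>" "\<forall>x<m. x \<in> set \<alpha> \<longleftrightarrow> x \<in> set \<beta>"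
    and "length \<alpha> = length \<beta>" "sorted_wrt (<) \<alpha>" "sorted_wrt (<) \<beta>"
  shows "\<alpha> < \<beta>"
proof (rule ccontr)
  assume "\<not> \<alpha> < \<beta>"
  moreover have "\<alpha> \<noteq> \<beta>" using m(1) by auto
  ultimately have "\<beta> < \<alpha>" by simp
  then obtain m' where "m' \<in> set \<beta> - set \<alpha>" "\<forall>x<m'. x \<in> set \<beta> \<longleftrightarrow> x \<in> set \<alpha>"
    using list_less_imp_first_difference assms(3-5) by metis
  with m show False by (cases m m' rule: linorder_cases) auto
qed

text \<open>The complements first differ at the same \<open>m\<close>, but there membership has
  switched sides.\<close>

lemma complement_seq_antimono:
  assumes "\<alpha> \<in> set (Q k n)" "\<beta> \<in> set (Q k n)" "\<alpha> < \<beta>"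
  shows "complement_seq n \<beta> < complement_seq n \<alpha>"
proof -
  obtain m where m: "m \<in> set \<alpha> - set \<beta>" "\<forall>x<m. x \<in> set \<alpha> \<longleftrightarrow> x \<in> set \<beta>"
    using list_less_imp_first_difference[OF assms(3)] assms(1,2) by (auto simp: set_Q)
  have "m \<in> {1..n}" using m(1) assms(1) by (auto simp: set_Q)
  then show ?thesis
    using m assms length_complement_seq
    by (intro first_difference_imp_list_less[of m]) auto
qed

lemma map_complement_seq_Q:
  assumes "k \<le> n"
  shows "map (complement_seq n) (Q k n) = rev (Q (n - k) n)"
proof -
  have "set (map (complement_seq n) (Q k n)) = set (Q (n - k) n)"
  proof (intro equalityI subsetI)
    fix \<beta> assume \<beta>: "\<beta> \<in> set (Q (n - k) n)"
    then have "complement_seq n \<beta> \<in> set (Q k n)"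
      using complement_seq_in_Q[OF \<beta>] assms by simp
    moreover have "\<beta> = complement_seq n (complement_seq n \<beta>)"
      using complement_complement_seq[OF \<beta>] by simp
    ultimately show "\<beta> \<in> set (map (complement_seq n) (Q k n))" by auto
  qed (use complement_seq_in_Q in auto)
  moreover have "sorted_wrt (<) (rev (map (complement_seq n) (Q k n)))"
    unfolding sorted_wrt_rev sorted_wrt_map
    by (rule sorted_wrt_mono_rel[OF _ sorted_Q]) (rule complement_seq_antimono)
  ultimately have "rev (map (complement_seq n) (Q k n)) = Q (n - k) n"
    by (intro strict_sorted_equal) (auto simp: sorted_Q)
  then show ?thesis by (simp flip: rev_swap)
qed

text \<open>This interprets the anti-diagonal of \<open>U_mat\<close>: the reflection of positions,
  \<open>i\<close> to \<open>r + 1 - i\<close> when counted from 1, is complementation of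
  sequences.\<close>

lemma nth_Q_complement:
  assumes "k \<le> n" "i < n choose k"
  shows "Q (n - k) n ! ((n choose k) - 1 - i) = complement_seq n (Q k n ! i)"
proof -
  have "complement_seq n (Q k n ! i) = rev (Q (n - k) n) ! i"
    using map_complement_seq_Q[OF assms(1)] assms(2) by (metis length_Q nth_map)
  also have "\<dots> = Q (n - k) n ! ((n choose k) - 1 - i)"
    using assms by (simp add: rev_nth length_Q flip: binomial_symmetric)
  finally show ?thesis by simp
qed

section \<open>Orthogonality relations between complementary minors\<close>

lemma laplace_expansion_minors:
  fixes A :: "'a :: idom mat"
  assumes A: "A \<in> carrier_mat n n" and "k \<le> n" and \<beta>: "\<beta> \<in> set (Q k n)" and \<gamma>: "\<gamma> \<in> set (Q k n)"
  shows "(\<Sum>\<alpha>\<in>set (Q k n). signature \<alpha> * signature \<gamma> * minor A \<alpha> \<beta>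
      * minor A (complement_seq n \<alpha>) (complement_seq n \<gamma>)) = (if \<beta> = \<gamma> then det A else 0)"
proof -
  define \<delta> where "\<delta> = \<beta> @ complement_seq n \<gamma>"
  define B where "B = mat n n (\<lambda>(i, j). A $$ (i, \<delta> ! j - 1))"
  define s :: 'a where "s = signature [1..<Suc k]"
  have len: "length \<beta> = k" "length \<gamma> = k" "length (complement_seq n \<gamma>) = n - k"
    using \<beta> \<gamma> length_complement_seq by (auto simp: set_Q)
  have B: "B \<in> carrier_mat n n" by (simp add: B_def)
  have "det B = (\<Sum>\<alpha>\<in>set (Q k n). signature \<alpha> * s * minor A \<alpha> \<beta>
      * minor A (complement_seq n \<alpha>) (complement_seq n \<gamma>))"
    unfolding laplace_expansion_columns[OF B \<open>k \<le> n\<close>]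
  proof (rule sum.cong)
    fix \<alpha> assume \<alpha>: "\<alpha> \<in> set (Q k n)"
    have len\<alpha>: "length \<alpha> = k" "length (complement_seq n \<alpha>) = n - k"
      using \<alpha> length_complement_seq by (auto simp: set_Q)
    have in\<alpha>: "\<alpha> ! i - 1 < n" if "i < k" for i
    proof -
      have "\<alpha> ! i \<in> {1..n}" using \<alpha> that len\<alpha>(1) nth_mem[of i \<alpha>]
        by (auto simp: set_Q simp del: atLeastAtMost_iff)
      then show ?thesis by auto
    qed
    have inc: "complement_seq n \<alpha> ! i - 1 < n" if "i < n - k" for i
      using len\<alpha>(2) that nth_mem[of i "complement_seq n \<alpha>"] by auto
    have "mat k k (\<lambda>(i, j). B $$ (\<alpha> ! i - 1, j)) = mat k k (\<lambda>(i, j). A $$ (\<alpha> ! i - 1, \<beta> ! j - 1))"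
      using in\<alpha> len \<open>k \<le> n\<close> by (intro cong_mat) (auto simp: B_def \<delta>_def nth_append)
    moreover have "mat (n - k) (n - k) (\<lambda>(i, j). B $$ (complement_seq n \<alpha> ! i - 1, k + j))
      = mat (n - k) (n - k) (\<lambda>(i, j). A $$ (complement_seq n \<alpha> ! i - 1, complement_seq n \<gamma> ! j - 1))"
      using inc len \<open>k \<le> n\<close> by (intro cong_mat) (auto simp: B_def \<delta>_def nth_append)
    ultimately show "signature \<alpha> * signature [1..<Suc k]
      * det (mat k k (\<lambda>(i, j). B $$ (\<alpha> ! i - 1, j)))
      * det (mat (n - k) (n - k) (\<lambda>(i, j). B $$ (complement_seq n \<alpha> ! i - 1, k + j)))
      = signature \<alpha> * s * minor A \<alpha> \<beta> * minor A (complement_seq n \<alpha>) (complement_seq n \<gamma>)"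
      by (simp only: minor_def len len\<alpha> s_def)
  qed simp
  \<comment> \<open>The expansion of \<open>det B\<close> carries the sign \<open>s\<close> where
    the claim has \<open>signature \<gamma>\<close>; multiplying by both leaves
    \<open>s * s = 1\<close>.\<close>
  then have "signature \<gamma> * s * det B = (s * s) * (\<Sum>\<alpha>\<in>set (Q k n).
      signature \<alpha> * signature \<gamma> * minor A \<alpha> \<beta>
      * minor A (complement_seq n \<alpha>) (complement_seq n \<gamma>))"
    by (simp add: sum_distrib_left ac_simps)
  then have "(\<Sum>\<alpha>\<in>set (Q k n). signature \<alpha> * signature \<gamma> * minor A \<alpha> \<beta>
      * minor A (complement_seq n \<alpha>) (complement_seq n \<gamma>)) = signature \<gamma> * s * det B"
    by (simp add: s_def signature_mult_self del: upt_Suc)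
  also have "\<dots> = (if \<beta> = \<gamma> then det A else 0)"
  proof (cases "\<beta> = \<gamma>")
    case True
    have \<beta>': "sorted_wrt (<) \<beta>" "set \<beta> \<subseteq> {1..n}" using \<beta> by (auto simp: set_Q)
    have in\<delta>: "\<delta> ! i - 1 < n" if "i < n" for i
      using that nth_mem[of i \<delta>] \<beta>'(2) len \<open>k \<le> n\<close> unfolding \<delta>_def by force
    \<comment> \<open>\<open>det_rows_append\<close> rearranges rows, whereas
      \<open>\<delta>\<close> rearranges columns; hence the passage to the transpose.\<close>
    have "det B = det (transpose_mat B)" by (simp add: det_transpose[OF B])
    also have "transpose_mat B = mat n n (\<lambda>(i, j). transpose_mat A $$ (\<delta> ! i - 1, j))"
      using A in\<delta> by (intro eq_matI) (auto simp: B_def)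
    also have "det \<dots> = signature \<beta> * s * det (transpose_mat A)"
      unfolding \<delta>_def s_def len(1)[symmetric]
      using A \<beta>' len True \<open>k \<le> n\<close> by (intro det_rows_append) auto
    also have "det (transpose_mat A) = det A" by (rule det_transpose[OF A])
    finally have "signature \<gamma> * s * det B = (signature \<gamma> * signature \<gamma>) * (s * s) * det A"
      using True by (simp add: ac_simps)
    then show ?thesis using True by (simp add: s_def signature_mult_self del: upt_Suc)
  next
    case False
    \<comment> \<open>By equal cardinality some \<open>x\<close> in \<open>\<beta>\<close> is
      outside \<open>\<gamma>\<close>, so column \<open>x\<close> of \<open>A\<close> occurs in both
      parts of \<open>B\<close>.\<close>
    have "\<not> set \<beta> \<subseteq> set \<gamma>"
    proof
      assume "set \<beta> \<subseteq> set \<gamma>"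
      moreover have "card (set \<beta>) = card (set \<gamma>)"
        using \<beta> \<gamma> by (auto simp: set_Q strict_sorted_iff distinct_card)
      ultimately have "set \<beta> = set \<gamma>" by (intro card_subset_eq) auto
      then show False using False \<beta> \<gamma> strict_sorted_equal by (auto simp: set_Q)
    qed
    then obtain x where "x \<in> set \<beta>" "x \<notin> set \<gamma>" by blast
    then have "x \<in> set \<beta>" "x \<in> set (complement_seq n \<gamma>)" using \<beta> by (auto simp: set_Q)
    then obtain i j where ij: "i < k" "j < n - k" "\<beta> ! i = x" "complement_seq n \<gamma> ! j = x"
      using len by (metis in_set_conv_nth)
    have "det B = 0"
    proof (rule det_identical_columns[OF B])
      show "i \<noteq> k + j" "i < n" "k + j < n" using ij \<open>k \<le> n\<close> by auto
      show "col B i = col B (k + j)"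
        using ij len by (intro eq_vecI) (auto simp: B_def \<delta>_def nth_append)
    qed
    then show ?thesis using False by simp
  qed
  finally show ?thesis .
qed

section \<open>Entries of the compound product\<close>

text \<open>The same anti-diagonal condition solved for the row and for the column, so that a sum
  over either index collapses to one term.\<close>

lemma index_U_mat:
  assumes "i < n choose k" "j < n choose k"
  shows "U_mat k n $$ (i, j) = (if i = (n choose k) - 1 - j then signature (Q k n ! j) else 0)"
    and "U_mat k n $$ (i, j) = (if j = (n choose k) - 1 - i then signature (Q k n ! j) else 0)"
  using assms by (auto simp: U_mat_def Let_def)

theorem theorem7:
  fixes n k :: nat and A :: "complex mat"
  assumes "n \<ge> 2" and "k \<in> {1..n - 1}" and "A \<in> carrier_mat n n"
  shows "transpose_mat (mult_compound k A) * transpose_mat (U_mat k n)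
      * mult_compound (n - k) A * U_mat k n
    = det A \<cdot>\<^sub>m 1\<^sub>m (n choose k)"
proof -
  define r where "r = n choose k"
  let ?M = "mult_compound k A" and ?N = "mult_compound (n - k) A"
  let ?U = "U_mat k n :: complex mat"
  have k: "k \<le> n" using assms(2) by auto
  have dim: "dim_row A = n" "n choose (n - k) = r" 
    using assms(3) k by (auto simp: r_def simp flip: binomial_symmetric)
  have M: "?M \<in> carrier_mat r r" and N: "?N \<in> carrier_mat r r" and U: "?U \<in> carrier_mat r r"
    using dim by (auto simp: mult_compound_def U_mat_def Let_def r_def)
  define T where "T = transpose_mat ?M * transpose_mat ?U"
  have T: "T \<in> carrier_mat r r" using M U by (auto simp: T_def)
  \<comment> \<open>Multiplying by the transpose of \<open>U_mat\<close> reverses the columns and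
    attaches to each the signature of the sequence at the reflected position.\<close>
  have T_index: "T $$ (i, b)
    = minor A (Q k n ! (r - 1 - b)) (Q k n ! i) * signature (Q k n ! (r - 1 - b))"
    if "i < r" "b < r" for i b
  proof -
    have "T $$ (i, b)
      = (\<Sum>a = 0..<r. ?M $$ (a, i) * ?U $$ (b, a))"
      using that M U by (simp add: T_def scalar_prod_def)
    also have "\<dots> = (\<Sum>a = 0..<r. if a = r - 1 - b then
        minor A (Q k n ! a) (Q k n ! i) * signature (Q k n ! a) else 0)"
      using that dim by (intro sum.cong)
        (auto simp: r_def index_U_mat(2) mult_compound_def Let_def)
    finally show ?thesis using that by simp
  qed
  have TU: "(T * ?N * ?U) $$ (i, j)
    = (if i = j then det A else 0)"
    if ij: "i < r" "j < r" for i j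
  proof -
    have j': "r - 1 - j < r" using ij by simp
    have "(T * ?N * ?U) $$ (i, j)
      = (\<Sum>a = 0..<r. (T * ?N) $$ (i, a) * ?U $$ (a, j))"
      using ij T N U by (simp add: scalar_prod_def del: assoc_mult_mat)
    also have "\<dots> = (\<Sum>a = 0..<r. if a = r - 1 - j then
        (T * ?N) $$ (i, a) * signature (Q k n ! j) else 0)"
      using ij by (intro sum.cong) (auto simp: r_def index_U_mat(1))
    also have "\<dots> = (T * ?N) $$ (i, r - 1 - j)
        * signature (Q k n ! j)"
      using j' by simp
    also have "(T * ?N) $$ (i, r - 1 - j)
      = (\<Sum>b<r. T $$ (i, b) * ?N $$ (b, r - 1 - j))"
      using ij T N by (simp add: scalar_prod_def atLeast0LessThan)
    \<comment> \<open>Reversing the summation cancels the reflection inside \<open>T\<close> and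
      reflects both indices of \<open>?N\<close>, which \<open>nth_Q_complement\<close> then turns
      into complements.\<close>
    also have "\<dots> = (\<Sum>a<r. T $$ (i, r - 1 - a)
        * ?N $$ (r - 1 - a, r - 1 - j))"
      by (subst sum.nat_diff_reindex[symmetric]) simp
    also have "\<dots> = (\<Sum>a<r. minor A (Q k n ! a) (Q k n ! i) * signature (Q k n ! a)
        * minor A (complement_seq n (Q k n ! a)) (complement_seq n (Q k n ! j)))"
    proof (rule sum.cong)
      fix a assume "a \<in> {..<r}"
      then have a: "a < r" "r - 1 - a < r" by auto
      have "?N $$ (r - 1 - a, r - 1 - j)
        = minor A (complement_seq n (Q k n ! a)) (complement_seq n (Q k n ! j))"
        using a j' ij dim k
        by (simp add: mult_compound_def Let_def nth_Q_complement[OF k, symmetric] r_def)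
      then show "T $$ (i, r - 1 - a)
          * ?N $$ (r - 1 - a, r - 1 - j)
        = minor A (Q k n ! a) (Q k n ! i) * signature (Q k n ! a)
          * minor A (complement_seq n (Q k n ! a)) (complement_seq n (Q k n ! j))"
        using T_index[OF ij(1) a(2)] a(1) by simp
    qed simp
    \<comment> \<open>The summand is written as a function applied to \<open>Q k n ! a\<close> so
      that the sum over positions can be reindexed as a sum over sequences.\<close>
    also have "\<dots> * signature (Q k n ! j)
      = (\<Sum>a<r. (\<lambda>\<alpha>. signature \<alpha> * signature (Q k n ! j) * minor A \<alpha> (Q k n ! i)
        * minor A (complement_seq n \<alpha>) (complement_seq n (Q k n ! j))) (Q k n ! a))"
      unfolding sum_distrib_right by (simp add: ac_simps)
    also have "\<dots> = (\<Sum>\<alpha>\<in>set (Q k n). signature \<alpha> * signature (Q k n ! j)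
        * minor A \<alpha> (Q k n ! i) * minor A (complement_seq n \<alpha>) (complement_seq n (Q k n ! j)))"
      by (rule sum.reindex_bij_betw, rule bij_betw_nth)
        (use sorted_Q in \<open>auto simp: length_Q r_def strict_sorted_iff\<close>)
    also have "\<dots> = (if Q k n ! i = Q k n ! j then det A else 0)"
      using ij assms(3) k by (intro laplace_expansion_minors) (auto simp: length_Q r_def)
    \<comment> \<open>\<open>Q k n\<close> is strictly sorted, hence without repetitions.\<close>
    also have "Q k n ! i = Q k n ! j \<longleftrightarrow> i = j"
      using ij sorted_Q[of k n]
      by (intro nth_eq_iff_index_eq) (auto simp: length_Q r_def strict_sorted_iff)
    finally show ?thesis .
  qed
  show ?thesis
    unfolding r_def[symmetric] T_def[symmetric] using TU M T U by (intro eq_matI) auto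
qed

end
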